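(* Let $f:[a,b]\times\mathbb R\to\mathbb R$ be continuous and Lipschitz continuous in its second argument, i.e. there is a constant $L$ with $|f(t,u_1)-f(t,u_2)|\le L|u_1-u_2|$ for all $t\in[a,b]$, $u_1,u_2\in\mathbb R$, and let $u$ be the solution of $u'=f(t,u)$ on $[a,b]$, $u(a)=u_0$. Let $a_{ij}$ ($1\le j<i\le4$), $b_1,\dots,b_4$, $c_2,c_3,c_4$ be real coefficients satisfying $$b_1+b_2+b_3+b_4=1,\qquad a_{21}=c_2,\qquad a_{31}+a_{32}=c_3,\qquad a_{41}+a_{42}+a_{43}=c_4,$$ $$b_2c_2+b_3c_3+b_4c_4=\tfrac12,\quad b_2c_2^2+b_3c_3^2+b_4c_4^2=\tfrac13,\quad b_2c_2^3+b_3c_3^3+b_4c_4^3=\tfrac14,$$ $$a_{32}b_3c_2+a_{42}b_4c_2+a_{43}b_4c_3=\tfrac16,\quad a_{32}b_3c_2c_3+a_{42}b_4c_2c_4+a_{43}b_4c_3c_4=\tfrac18,$$ $$a_{32}b_3c_2^2+a_{42}b_4c_2^2+a_{43}b_4c_3^2=\tfrac1{12},\quad a_{32}a_{43}b_4c_2=\tfrac1{24}.$$ Suppose that the squared shape parameters $\epsilon_{n2}^2,\epsilon_{n3}^2,\epsilon_{n4}^2\in\mathbb R$ are bounded for all $n=0,1,\dots,N-1$ (by a bound independent of $n$ and of $h$). Then the four-stage RBF Runge-Kutta method defined in the context converges to the exact solution: with $h=(b-a)/N$, $v_N\to u(b)$ as $h\to0$ (equivalently $N\to\infty$).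
   Context: For $N\ge1$ let $h=(b-a)/N$ and $t_n=a+nh$, $n=0,\dots,N$. The four-stage RBF Runge-Kutta method with squared shape parameters $\epsilon_{n2}^2,\epsilon_{n3}^2,\epsilon_{n4}^2\in\mathbb R$ (the shape parameters are real or purely imaginary; they may vary with $n$ and $h$) produces $v_0=u_0$ and, for $n=0,\dots,N-1$, $$v_{n+1}=v_n+h(b_1k_1+b_2k_2+b_3k_3+b_4k_4),\quad k_1=f(t_n,v_n),$$ $$k_2=f\big(t_n+c_2h,\;v_ne^{-\epsilon_{n2}^2(c_2h)^2}+h\,a_{21}k_1\big),\quad k_3=f\big(t_n+c_3h,\;v_ne^{-\epsilon_{n3}^2(c_3h)^2}+h(a_{31}k_1+a_{32}k_2)\big),$$ $$k_4=f\big(t_n+c_4h,\;v_ne^{-\epsilon_{n4}^2(c_4h)^2}+h(a_{41}k_1+a_{42}k_2+a_{43}k_3)\big).$$ It is understood that $f$ is defined (and has the stated properties) at all the arguments occurring in the method. *)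

theory Defs
  imports "HOL-Analysis.Analysis"
begin

text \<open>
  Coefficients are indexed as in a Butcher tableau: \<open>A i j\<close> is $a_{ij}$, \<open>B i\<close> is $b_i$, \<open>c i\<close> is
  $c_i$; only the entries $1 \le j < i \le 4$ of \<open>A\<close>, $1 \le i \le 4$ of \<open>B\<close> and $2 \le i \le 4$ of
  \<open>c\<close> are ever used.  The argument \<open>e i\<close> is the \<^emph>\<open>squared\<close> shape parameter of stage \<open>i\<close>; it is an
  arbitrary real, negative values corresponding to purely imaginary shape parameters.
\<close>

definition rbf_rk4_step ::
  "(real \<Rightarrow> real \<Rightarrow> real) \<Rightarrow> (nat \<Rightarrow> nat \<Rightarrow> real) \<Rightarrow> (nat \<Rightarrow> real) \<Rightarrow> (nat \<Rightarrow> real)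
    \<Rightarrow> (nat \<Rightarrow> real) \<Rightarrow> real \<Rightarrow> real \<Rightarrow> real \<Rightarrow> real" where
  "rbf_rk4_step f A B c e h t v =
    (let k1 = f t v;
         k2 = f (t + c 2 * h) (v * exp (- (e 2 * (c 2 * h)\<^sup>2)) + h * (A 2 1 * k1));
         k3 = f (t + c 3 * h) (v * exp (- (e 3 * (c 3 * h)\<^sup>2)) + h * (A 3 1 * k1 + A 3 2 * k2));
         k4 = f (t + c 4 * h)
                (v * exp (- (e 4 * (c 4 * h)\<^sup>2)) + h * (A 4 1 * k1 + A 4 2 * k2 + A 4 3 * k3))
     in v + h * (B 1 * k1 + B 2 * k2 + B 3 * k3 + B 4 * k4))"

text \<open>
  The numerical solution $v_n$ with step size \<open>h\<close>, initial time \<open>t0\<close> and initial value \<open>u0\<close>, where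
  \<open>e n i\<close> is $\epsilon_{ni}^2$.
\<close>

primrec rbf_rk4 ::
  "(real \<Rightarrow> real \<Rightarrow> real) \<Rightarrow> (nat \<Rightarrow> nat \<Rightarrow> real) \<Rightarrow> (nat \<Rightarrow> real) \<Rightarrow> (nat \<Rightarrow> real)
    \<Rightarrow> (nat \<Rightarrow> nat \<Rightarrow> real) \<Rightarrow> real \<Rightarrow> real \<Rightarrow> real \<Rightarrow> nat \<Rightarrow> real" where
  "rbf_rk4 f A B c e h t0 u0 0 = u0"
| "rbf_rk4 f A B c e h t0 u0 (Suc n) =
    rbf_rk4_step f A B c (e n) h (t0 + real n * h) (rbf_rk4 f A B c e h t0 u0 n)"

text \<open>
  The stage times $t_n + c_i h$ may leave $[a,b]$ when some $c_i \notin [0,1]$.  A set \<open>T\<close> of times at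
  which the right-hand side is required to be well behaved must contain $[a,b]$ and all stage times
  of all step sizes $h = (b-a)/N$; if every $c_i \in [0,1]$, then $T = [a,b]$ qualifies.
\<close>

definition contains_stage_times :: "real set \<Rightarrow> real \<Rightarrow> real \<Rightarrow> (nat \<Rightarrow> real) \<Rightarrow> bool" where
  "contains_stage_times T a b c \<longleftrightarrow>
    {a..b} \<subseteq> T \<and>
    (\<forall>N\<ge>1. \<forall>n<N. \<forall>i\<in>{2,3,4}. (a + real n * ((b - a) / real N)) + c i * ((b - a) / real N) \<in> T)"

lemma contains_stage_times_interval:
  assumes "a < b" and c: "\<And>i. i \<in> {2,3,4} \<Longrightarrow> 0 \<le> c i \<and> c i \<le> 1"
  shows "contains_stage_times {a..b} a b c"
  unfolding contains_stage_times_def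
proof (intro conjI allI impI ballI)
  fix N n i :: nat assume N: "1 \<le> N" and n: "n < N" and i: "i \<in> {2,3,4}"
  define h where "h = (b - a) / real N"
  have h: "h \<ge> 0" "real N * h = b - a" using N \<open>a < b\<close> by (auto simp: h_def)
  have "0 \<le> real n + c i" "real n + c i \<le> real N" using c[OF i] n by linarith+
  then have "0 \<le> (real n + c i) * h" "(real n + c i) * h \<le> real N * h"
    using h(1) by (blast intro: mult_nonneg_nonneg mult_right_mono)+
  then show "a + real n * ((b - a) / real N) + c i * ((b - a) / real N) \<in> {a..b}"
    unfolding h_def[symmetric] using h(2) by (simp add: distrib_right)
qed simp

end

theory Submission
  imports Defs
begin

text \<open>
  Convergence is consistency plus stability: the weights \<open>B\<close> sum to \<open>1\<close>, so that a step follows the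
  exact slope up to an error that is small uniformly in the step, and the Lipschitz condition lets
  these errors grow by at most a bounded factor.  Write $\delta_n = |v_n - u(t_n)| + \eta$ for a
  tolerance $\eta \le 1$.  If the step size is so small that $h \le \eta$, that the factors
  $e^{-\epsilon_{ni}^2 (c_i h)^2}$ differ from $1$ by at most $\eta$, and that $f(\cdot, u(t_n))$
  changes by at most $\eta$ between $t_n$ and the stage times, then each stage value $k_i$ differs
  from the exact slope $f(t_n, u(t_n))$ by at most a constant times $\delta_n$; the constant depends
  on the Lipschitz constant, the tableau and a bound for $u$ and $u'$, but not on $n$, $h$ or
  $\eta$ (\<open>rbf_rk4_step_slope_error\<close>).  As the weights sum to $1$, the increment
  $v_{n+1} - v_n$ is then $h f(t_n, u(t_n))$ up to a multiple of $h \delta_n$, and so is the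
  increment of $u$, because $u'$ is uniformly continuous (\<open>euler_increment_error\<close>).
  Hence $\delta_{n+1} \le (1 + h K) \delta_n$, and $\delta_0 = \eta$ gives
  $\delta_N \le \eta\, e^{K (b - a)}$, where $\eta$ is arbitrarily small.

  No rate is obtained: a merely continuous $f$ does not provide one.  The stage times may lie
  outside $[a,b]$, in a set of times that need not be compact, so uniformity in the last
  smallness condition comes from the compactness of the graph of $u$ inside the larger
  domain on which $f$ is continuous (\<open>continuous_on_uniform_at_compact\<close>).
\<close>

section \<open>Uniform continuity and the increments of the solution\<close>

text \<open>
  Compactness of \<open>K\<close> alone makes the modulus of continuity uniform over base points in \<open>K\<close>, even
  though the second point ranges over all of \<open>S\<close>: otherwise there are bad pairs whose base points
  converge in \<open>K\<close> along a subsequence, and continuity of \<open>g\<close> at the limit is violated.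
\<close>

lemma continuous_on_uniform_at_compact:
  fixes g :: "'a::metric_space \<Rightarrow> 'b::metric_space"
  assumes "compact K" "K \<subseteq> S" "continuous_on S g" "0 < e"
  obtains d where "0 < d" "\<And>x y. x \<in> K \<Longrightarrow> y \<in> S \<Longrightarrow> dist y x < d \<Longrightarrow> dist (g y) (g x) < e"
proof -
  have "\<exists>d>0. \<forall>x\<in>K. \<forall>y\<in>S. dist y x < d \<longrightarrow> dist (g y) (g x) < e"
  proof (rule ccontr)
    assume "\<not> ?thesis"
    then have "\<forall>n. \<exists>x y. x \<in> K \<and> y \<in> S \<and> dist y x < inverse (Suc n) \<and> \<not> dist (g y) (g x) < e"
      by (metis inverse_positive_iff_positive of_nat_0_less_iff zero_less_Suc)
    then obtain x y where xy: "\<And>n. x n \<in> K" "\<And>n. y n \<in> S"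
      "\<And>n. dist (y n) (x n) < inverse (Suc n)" "\<And>n. \<not> dist (g (y n)) (g (x n)) < e"
      by metis
    obtain l r where l: "l \<in> K" "strict_mono (r :: nat \<Rightarrow> nat)" "(x \<circ> r) \<longlonglongrightarrow> l"
      using \<open>compact K\<close> xy(1) unfolding compact_def by metis
    have "(\<lambda>n. dist (y n) (x n)) \<longlonglongrightarrow> 0"
      by (rule tendsto_sandwich[OF _ _ tendsto_const LIMSEQ_inverse_real_of_nat])
        (auto intro!: always_eventually less_imp_le[OF xy(3)] simp del: of_nat_Suc)
    then have "(\<lambda>n. dist (y (r n)) (x (r n))) \<longlonglongrightarrow> 0"
      using l(2) LIMSEQ_subseq_LIMSEQ by (fastforce simp: o_def)
    moreover have "(\<lambda>n. dist (x (r n)) l) \<longlonglongrightarrow> 0"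
      using l(3) tendsto_dist_iff by (force simp: o_def)
    ultimately have "(\<lambda>n. dist (y (r n)) (x (r n)) + dist (x (r n)) l) \<longlonglongrightarrow> 0"
      using tendsto_add by fastforce
    then have "(\<lambda>n. dist (y (r n)) l) \<longlonglongrightarrow> 0"
      by (rule tendsto_sandwich[OF _ _ tendsto_const, rotated 2])
        (auto intro!: always_eventually dist_triangle)
    then have "(\<lambda>n. y (r n)) \<longlonglongrightarrow> l"
      using tendsto_dist_iff by blast
    then have "(\<lambda>n. g (y (r n))) \<longlonglongrightarrow> g l"
      using assms(2,3) l(1) xy(2) by (intro continuous_on_tendsto_compose[OF assms(3)]) auto
    moreover have "(\<lambda>n. g (x (r n))) \<longlonglongrightarrow> g l"
      using assms(2,3) l(1,3) xy(1)
      by (intro continuous_on_tendsto_compose[OF assms(3)]) (auto simp: o_def intro!: always_eventually)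
    ultimately have "(\<lambda>n. dist (g (y (r n))) (g (x (r n)))) \<longlonglongrightarrow> 0"
      using tendsto_dist by fastforce
    then have "\<forall>\<^sub>F n in sequentially. dist (g (y (r n))) (g (x (r n))) < e"
      using \<open>0 < e\<close> by (rule order_tendstoD)
    then show False
      using xy(4) by (auto simp: eventually_sequentially)
  qed
  then show ?thesis using that by blast
qed

text \<open>
  The increment of \<open>u\<close> is a step times the derivative at an intermediate point, and the
  uniformly continuous derivative changes little over a short step.
\<close>

lemma euler_increment_error:
  fixes u u' :: "real \<Rightarrow> real"
  assumes "\<And>t. t \<in> {a..b} \<Longrightarrow> (u has_real_derivative u' t) (at t within {a..b})"
    and "continuous_on {a..b} u'" and "0 < \<eta>"
  obtains d where "0 < d"
    "\<And>t h. a \<le> t \<Longrightarrow> t + h \<le> b \<Longrightarrow> 0 < h \<Longrightarrow> h < d \<Longrightarrow> \<bar>u (t + h) - u t - h * u' t\<bar> \<le> h * \<eta>"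
proof -
  obtain d where d: "0 < d"
    "\<And>x y. x \<in> {a..b} \<Longrightarrow> y \<in> {a..b} \<Longrightarrow> dist y x < d \<Longrightarrow> dist (u' y) (u' x) < \<eta>"
    using continuous_on_uniform_at_compact[OF compact_Icc order_refl assms(2,3)] by metis
  have "\<bar>u (t + h) - u t - h * u' t\<bar> \<le> h * \<eta>"
    if th: "a \<le> t" "t + h \<le> b" "0 < h" "h < d" for t h
  proof -
    have "(u has_derivative (\<lambda>y. u' z * y)) (at z within {t..t + h})" if "t \<le> z" "z \<le> t + h" for z
      by (rule has_derivative_subset[OF assms(1)[unfolded has_field_derivative_def]])
        (use th that in auto)
    then have "\<exists>z\<in>{t..t + h}. u (t + h) - u t = u' z * (t + h - t)"
      using th by (intro mvt_very_simple) auto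
    then obtain z where z: "t \<le> z" "z \<le> t + h" "u (t + h) - u t = h * u' z" by (auto simp: mult.commute)
    then have "\<bar>u' z - u' t\<bar> < \<eta>"
      using d(2)[of t z] th by (auto simp: dist_real_def)
    then have "h * \<bar>u' z - u' t\<bar> \<le> h * \<eta>" using th by simp
    then show ?thesis using th z(3) by (simp add: abs_mult flip: right_diff_distrib)
  qed
  then show ?thesis using that d(1) by blast
qed

section \<open>Slope error of a single step\<close>

text \<open>
  This is the induction step from one stage to the next, with \<open>g\<close> the right-hand side at the stage
  time, \<open>\<phi>\<close> the exact slope, \<open>E\<close> the damping factor and \<open>p\<close> the contribution of the previous stages.
  The argument of \<open>g\<close> differs from \<open>w\<close> by $(v - w) E + w (E - 1) + p$, each term of which is at most
  a multiple of \<open>\<bar>v - w\<bar> + \<eta>\<close>; hence estimates relative to this quantity pass from stage to stage.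
\<close>

lemma damped_stage_error:
  fixes g :: "real \<Rightarrow> real"
  assumes lip: "\<And>x y. \<bar>g x - g y\<bar> \<le> L * \<bar>x - y\<bar>" and "0 \<le> L"
    and "\<bar>g w - \<phi>\<bar> \<le> \<eta>" "\<bar>E - 1\<bar> \<le> \<eta>" "\<eta> \<le> 1" "\<bar>w\<bar> \<le> M"
    and p: "\<bar>p\<bar> \<le> H * (\<bar>v - w\<bar> + \<eta>)"
  shows "\<bar>g (v * E + p) - \<phi>\<bar> \<le> (L * (2 + M + H) + 1) * (\<bar>v - w\<bar> + \<eta>)"
proof -
  have \<eta>: "0 \<le> \<eta>" and M: "0 \<le> M" using assms by linarith+
  have "v * E + p - w = (v - w) * E + w * (E - 1) + p" by (simp add: algebra_simps)
  then have "\<bar>v * E + p - w\<bar> \<le> \<bar>v - w\<bar> * \<bar>E\<bar> + \<bar>w\<bar> * \<bar>E - 1\<bar> + \<bar>p\<bar>"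
    unfolding abs_mult[symmetric] by linarith
  also have "\<dots> \<le> \<bar>v - w\<bar> * 2 + M * \<eta> + H * (\<bar>v - w\<bar> + \<eta>)"
    using assms M by (intro add_mono mult_mono) auto
  also have "\<dots> \<le> (2 + M + H) * (\<bar>v - w\<bar> + \<eta>)"
    using \<eta> mult_nonneg_nonneg[OF M abs_ge_zero[of "v - w"]] by (simp add: algebra_simps)
  finally have "L * \<bar>v * E + p - w\<bar> \<le> L * ((2 + M + H) * (\<bar>v - w\<bar> + \<eta>))"
    using \<open>0 \<le> L\<close> by (rule mult_left_mono)
  then have "\<bar>g (v * E + p) - g w\<bar> \<le> L * ((2 + M + H) * (\<bar>v - w\<bar> + \<eta>))"
    using lip order_trans by blast
  moreover have "\<bar>g w - \<phi>\<bar> \<le> \<bar>v - w\<bar> + \<eta>" using assms(3) by simp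
  ultimately have "\<bar>(g (v * E + p) - g w) + (g w - \<phi>)\<bar>
      \<le> L * ((2 + M + H) * (\<bar>v - w\<bar> + \<eta>)) + (\<bar>v - w\<bar> + \<eta>)"
    by (rule order_trans[OF abs_triangle_ineq add_mono])
  also have "\<dots> = (L * (2 + M + H) + 1) * (\<bar>v - w\<bar> + \<eta>)"
    by (simp only: distrib_right mult_1_left mult.assoc)
  finally show ?thesis by simp
qed

text \<open>
  A slope \<open>k\<close> is only bounded, not small, so its contribution to the next stage gets its smallness
  from the factor \<open>h \<le> D\<close>, while \<open>h \<le> 1\<close> suffices for its error, already proportional to \<open>D\<close>.
\<close>

lemma scaled_slope_bound:
  fixes k :: real
  assumes "\<bar>k - \<phi>\<bar> \<le> K * D" "\<bar>\<phi>\<bar> \<le> M" "0 \<le> h" "h \<le> 1" "h \<le> D"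
  shows "\<bar>h * k\<bar> \<le> (M + K) * D"
proof -
  have "0 \<le> M" "0 \<le> K * D" using assms by linarith+
  have "\<bar>h * k\<bar> \<le> h * (M + K * D)"
    using assms by (auto simp: abs_mult intro!: mult_left_mono)
  also have "\<dots> \<le> D * M + 1 * (K * D)"
    unfolding distrib_left using assms \<open>0 \<le> M\<close> \<open>0 \<le> K * D\<close> by (intro add_mono mult_right_mono) auto
  finally show ?thesis by (simp add: algebra_simps)
qed

text \<open>
  Here \<open>w\<close> is the exact solution at time \<open>t\<close>.  The constant \<open>K\<close> is chosen before \<open>f\<close>, the step
  size, the tolerance and the shape parameters, which is what makes the estimate uniform over all
  steps of all grids.
\<close>

lemma rbf_rk4_step_slope_error:
  fixes A :: "nat \<Rightarrow> nat \<Rightarrow> real" and B :: "nat \<Rightarrow> real"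
  assumes L: "0 \<le> L" and sumB: "B 1 + B 2 + B 3 + B 4 = 1"
  obtains K where "0 \<le> K"
    "\<And>f c e h t v w \<eta>.
      \<lbrakk>0 \<le> h; h \<le> \<eta>; \<eta> \<le> 1; \<bar>w\<bar> \<le> M; \<bar>f t w\<bar> \<le> M;
       \<And>x y. \<bar>f t x - f t y\<bar> \<le> L * \<bar>x - y\<bar>;
       \<And>i x y. i \<in> {2,3,4} \<Longrightarrow> \<bar>f (t + c i * h) x - f (t + c i * h) y\<bar> \<le> L * \<bar>x - y\<bar>;
       \<And>i. i \<in> {2,3,4} \<Longrightarrow> \<bar>f (t + c i * h) w - f t w\<bar> \<le> \<eta>;
       \<And>i. i \<in> {2,3,4} \<Longrightarrow> \<bar>exp (- (e i * (c i * h)\<^sup>2)) - 1\<bar> \<le> \<eta>\<rbrakk>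
      \<Longrightarrow> \<bar>rbf_rk4_step f A B c e h t v - (v + h * f t w)\<bar> \<le> h * (K * (\<bar>v - w\<bar> + \<eta>))"
proof -
  \<comment> \<open>The constants that \<open>damped_stage_error\<close> yields, with \<open>H\<close> obtained by adding up the bounds of
    \<open>scaled_slope_bound\<close> for the previous stages; the first stage has the constant \<open>L\<close>.\<close>
  define K2 where "K2 = L * (2 + M + \<bar>A 2 1\<bar> * (M + L)) + 1"
  define K3 where "K3 = L * (2 + M + (\<bar>A 3 1\<bar> * (M + L) + \<bar>A 3 2\<bar> * (M + K2))) + 1"
  define K4 where
    "K4 = L * (2 + M + (\<bar>A 4 1\<bar> * (M + L) + \<bar>A 4 2\<bar> * (M + K2) + \<bar>A 4 3\<bar> * (M + K3))) + 1"
  define K where "K = \<bar>B 1\<bar> * L + \<bar>B 2\<bar> * K2 + \<bar>B 3\<bar> * K3 + \<bar>B 4\<bar> * K4"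
  have main: "\<bar>rbf_rk4_step f A B c e h t v - (v + h * f t w)\<bar> \<le> h * (K * (\<bar>v - w\<bar> + \<eta>))"
    if h: "0 \<le> h" "h \<le> \<eta>" "\<eta> \<le> 1" and M: "\<bar>w\<bar> \<le> M" "\<bar>f t w\<bar> \<le> M"
      and lip1: "\<And>x y. \<bar>f t x - f t y\<bar> \<le> L * \<bar>x - y\<bar>"
      and lip: "\<And>i x y. i \<in> {2,3,4} \<Longrightarrow> \<bar>f (t + c i * h) x - f (t + c i * h) y\<bar> \<le> L * \<bar>x - y\<bar>"
      and tim: "\<And>i. i \<in> {2,3,4} \<Longrightarrow> \<bar>f (t + c i * h) w - f t w\<bar> \<le> \<eta>"
      and damp: "\<And>i. i \<in> {2,3,4} \<Longrightarrow> \<bar>exp (- (e i * (c i * h)\<^sup>2)) - 1\<bar> \<le> \<eta>"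
    for f c e h t v w \<eta>
  proof -
    define D where "D = \<bar>v - w\<bar> + \<eta>"
    define \<phi> where "\<phi> = f t w"
    define k1 where "k1 = f t v"
    define k2 where
      "k2 = f (t + c 2 * h) (v * exp (- (e 2 * (c 2 * h)\<^sup>2)) + h * (A 2 1 * k1))"
    define k3 where
      "k3 = f (t + c 3 * h) (v * exp (- (e 3 * (c 3 * h)\<^sup>2)) + h * (A 3 1 * k1 + A 3 2 * k2))"
    define k4 where
      "k4 = f (t + c 4 * h)
        (v * exp (- (e 4 * (c 4 * h)\<^sup>2)) + h * (A 4 1 * k1 + A 4 2 * k2 + A 4 3 * k3))"
    have D: "h \<le> D" "h \<le> 1" "0 \<le> D" using h by (auto simp: D_def)
    have stage: "\<bar>f (t + c i * h) (v * exp (- (e i * (c i * h)\<^sup>2)) + p) - \<phi>\<bar>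
        \<le> (L * (2 + M + H) + 1) * D" if "i \<in> {2,3,4}" "\<bar>p\<bar> \<le> H * D" for i p H
      unfolding D_def \<phi>_def
      by (rule damped_stage_error[OF lip[OF that(1)] L tim[OF that(1)] damp[OF that(1)]
            h(3) M(1) that(2)[unfolded D_def]])
    have hk: "\<bar>h * (x * k)\<bar> \<le> \<bar>x\<bar> * (M + C) * D" if "\<bar>k - \<phi>\<bar> \<le> C * D" for x k C
    proof -
      have "\<bar>x\<bar> * \<bar>h * k\<bar> \<le> \<bar>x\<bar> * ((M + C) * D)"
        by (intro mult_left_mono scaled_slope_bound[OF that]) (use M(2) h D in \<open>auto simp: \<phi>_def\<close>)
      then show ?thesis by (simp add: abs_mult algebra_simps)
    qed
    have k1: "\<bar>k1 - \<phi>\<bar> \<le> L * D"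
    proof -
      have "\<bar>k1 - \<phi>\<bar> \<le> L * \<bar>v - w\<bar>" unfolding k1_def \<phi>_def by (rule lip1)
      also have "\<dots> \<le> L * D" using L h by (intro mult_left_mono) (auto simp: D_def)
      finally show ?thesis .
    qed
    have k2: "\<bar>k2 - \<phi>\<bar> \<le> K2 * D"
      unfolding k2_def K2_def by (rule stage) (use hk[OF k1, of "A 2 1"] in auto)
    have k3: "\<bar>k3 - \<phi>\<bar> \<le> K3 * D"
      unfolding k3_def K3_def
      by (rule stage, simp, unfold distrib_left[of h] distrib_right[of _ _ D])
        (intro order_trans[OF abs_triangle_ineq] add_mono hk k1 k2)
    have k4: "\<bar>k4 - \<phi>\<bar> \<le> K4 * D"
      unfolding k4_def K4_def
      by (rule stage, simp, unfold distrib_left[of h] distrib_right[of _ _ D])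
        (intro order_trans[OF abs_triangle_ineq] add_mono hk k1 k2 k3)
    have wt: "\<bar>x * (k - \<phi>)\<bar> \<le> \<bar>x\<bar> * C * D" if "\<bar>k - \<phi>\<bar> \<le> C * D" for x k C
      using mult_left_mono[OF that, of "\<bar>x\<bar>"] by (simp add: abs_mult mult.assoc)
    have "\<bar>B 1 * (k1 - \<phi>) + B 2 * (k2 - \<phi>) + B 3 * (k3 - \<phi>) + B 4 * (k4 - \<phi>)\<bar> \<le> K * D"
      unfolding K_def distrib_right
      by (intro order_trans[OF abs_triangle_ineq] add_mono wt k1 k2 k3 k4)
    moreover have "B 1 * \<phi> + B 2 * \<phi> + B 3 * \<phi> + B 4 * \<phi> = \<phi>"
      unfolding distrib_right[symmetric] sumB by simp
    then have "B 1 * (k1 - \<phi>) + B 2 * (k2 - \<phi>) + B 3 * (k3 - \<phi>) + B 4 * (k4 - \<phi>)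
        = B 1 * k1 + B 2 * k2 + B 3 * k3 + B 4 * k4 - \<phi>"
      unfolding right_diff_distrib by linarith
    moreover have "rbf_rk4_step f A B c e h t v - (v + h * \<phi>)
        = h * (B 1 * k1 + B 2 * k2 + B 3 * k3 + B 4 * k4 - \<phi>)"
      unfolding rbf_rk4_step_def Let_def k1_def[symmetric] k2_def[symmetric] k3_def[symmetric]
        k4_def[symmetric] right_diff_distrib by simp
    ultimately have "\<bar>rbf_rk4_step f A B c e h t v - (v + h * \<phi>)\<bar> \<le> h * (K * D)"
      using h(1) by (simp only: abs_mult abs_of_nonneg mult_left_mono)
    then show ?thesis unfolding D_def \<phi>_def .
  qed
  show ?thesis
  \<comment> \<open>The bound \<open>M\<close> may be negative, and then so may \<open>K\<close>; in that case the estimate is vacuous.\<close>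
  proof (cases "0 \<le> M")
    case True
    then have "0 \<le> K"
      using L by (auto simp: K_def K2_def K3_def K4_def)
    show ?thesis by (rule that[OF \<open>0 \<le> K\<close>]) (rule main)
  next
    case False
    then show ?thesis by (intro that[of 0]) auto
  qed
qed

section \<open>Accumulation of the errors and convergence\<close>

lemma linear_recursion_exp_bound:
  fixes x :: "nat \<Rightarrow> real"
  assumes "\<And>n. n < N \<Longrightarrow> x (Suc n) \<le> (1 + q) * x n" "0 \<le> q" "0 \<le> x 0" "n \<le> N"
  shows "x n \<le> x 0 * exp (real n * q)"
  using \<open>n \<le> N\<close>
proof (induction n)
  case (Suc n)
  have "x (Suc n) \<le> (1 + q) * x n" using Suc.prems assms(1) by simp
  also have "\<dots> \<le> (1 + q) * (x 0 * exp (real n * q))"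
    using Suc assms(2) by (intro mult_left_mono) auto
  also have "\<dots> \<le> exp q * (x 0 * exp (real n * q))"
    using assms(3) by (intro mult_right_mono exp_ge_add_one_self) auto
  finally show ?case by (simp add: exp_add algebra_simps)
qed simp

text \<open>
  The squared shape parameters enter only through these factors, so
  a bound for them that holds on all grids makes the damping negligible uniformly as \<open>h\<close> tends
  to \<open>0\<close>.
\<close>

lemma damping_factor_near_one:
  fixes E :: "nat \<Rightarrow> nat \<Rightarrow> nat \<Rightarrow> real"
  assumes "\<And>N n i. N \<ge> 1 \<Longrightarrow> n < N \<Longrightarrow> i \<in> I \<Longrightarrow> \<bar>E N n i\<bar> \<le> C"
    and "finite I" "h \<longlonglongrightarrow> (0::real)" "0 < \<eta>"
  shows "\<forall>\<^sub>F N in sequentially. \<forall>n<N. \<forall>i\<in>I. \<bar>exp (- (E N n i * (c i * h N)\<^sup>2)) - 1\<bar> \<le> \<eta>"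
proof -
  have "isCont (exp :: real \<Rightarrow> real) 0" by simp
  then obtain r where r: "0 < r" "\<And>q::real. \<bar>q\<bar> < r \<Longrightarrow> \<bar>exp q - 1\<bar> < \<eta>"
    using \<open>0 < \<eta>\<close> unfolding continuous_at_eps_delta by (auto simp: dist_real_def)
  have "\<forall>\<^sub>F N in sequentially. C * (c i * h N)\<^sup>2 < r" for i
  proof -
    have "(\<lambda>N. C * (c i * h N)\<^sup>2) \<longlonglongrightarrow> C * (c i * 0)\<^sup>2"
      by (intro tendsto_intros assms)
    then show ?thesis using r(1) by (intro order_tendstoD(2)) auto
  qed
  then have "\<forall>\<^sub>F N in sequentially. \<forall>i\<in>I. C * (c i * h N)\<^sup>2 < r"
    using \<open>finite I\<close> by (simp add: eventually_ball_finite)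
  then show ?thesis
  proof eventually_elim
    case (elim N)
    have "\<bar>exp (- (E N n i * (c i * h N)\<^sup>2)) - 1\<bar> \<le> \<eta>" if "n < N" "i \<in> I" for n i
    proof -
      have "\<bar>E N n i\<bar> * (c i * h N)\<^sup>2 \<le> C * (c i * h N)\<^sup>2"
        using that assms(1) by (intro mult_right_mono) auto
      then show ?thesis
        using elim that by (intro less_imp_le r(2)) (auto simp: abs_mult)
    qed
    then show ?case by blast
  qed
qed

text \<open>
  For a tolerance \<open>\<eta>\<close>, all smallness conditions hold on every sufficiently fine grid, and there the
  quantity \<open>\<bar>v n - u (t n)\<bar> + \<eta>\<close> satisfies a linear recursive inequality
  without inhomogeneous term.
\<close>

theorem theorem4p3:
  fixes a b u0 L :: real
    and T :: "real set"
    and f :: "real \<Rightarrow> real \<Rightarrow> real"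
    and u :: "real \<Rightarrow> real"
    and A :: "nat \<Rightarrow> nat \<Rightarrow> real"
    and B c :: "nat \<Rightarrow> real"
    and eps2 :: "nat \<Rightarrow> nat \<Rightarrow> nat \<Rightarrow> real"
  assumes "a < b"
    and "contains_stage_times T a b c"
    and "continuous_on (T \<times> UNIV) (\<lambda>(t, x). f t x)"
    and "\<And>t x y. t \<in> T \<Longrightarrow> \<bar>f t x - f t y\<bar> \<le> L * \<bar>x - y\<bar>"
    and "\<And>t. t \<in> {a..b} \<Longrightarrow> (u has_real_derivative f t (u t)) (at t within {a..b})"
    and "u a = u0"
    and "B 1 + B 2 + B 3 + B 4 = 1"
    and "A 2 1 = c 2"
    and "A 3 1 + A 3 2 = c 3"
    and "A 4 1 + A 4 2 + A 4 3 = c 4"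
    and "B 2 * c 2 + B 3 * c 3 + B 4 * c 4 = 1 / 2"
    and "B 2 * (c 2)^2 + B 3 * (c 3)^2 + B 4 * (c 4)^2 = 1 / 3"
    and "B 2 * (c 2)^3 + B 3 * (c 3)^3 + B 4 * (c 4)^3 = 1 / 4"
    and "A 3 2 * B 3 * c 2 + A 4 2 * B 4 * c 2 + A 4 3 * B 4 * c 3 = 1 / 6"
    and "A 3 2 * B 3 * c 2 * c 3 + A 4 2 * B 4 * c 2 * c 4 + A 4 3 * B 4 * c 3 * c 4 = 1 / 8"
    and "A 3 2 * B 3 * (c 2)^2 + A 4 2 * B 4 * (c 2)^2 + A 4 3 * B 4 * (c 3)^2 = 1 / 12"
    and "A 3 2 * A 4 3 * B 4 * c 2 = 1 / 24"
    and "\<exists>C. \<forall>N\<ge>1. \<forall>n<N. \<forall>i\<in>{2,3,4}. \<bar>eps2 N n i\<bar> \<le> C"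
  shows "(\<lambda>N. rbf_rk4 f A B c (eps2 N) ((b - a) / real N) a u0 N) \<longlonglongrightarrow> u b"
proof -
  define h where "h = (\<lambda>N. (b - a) / real N)"
  have h0: "h \<longlonglongrightarrow> 0" unfolding h_def by (rule lim_const_over_n)
  \<comment> \<open>The given \<open>L\<close> may be negative.\<close>
  have lip: "\<bar>f t x - f t y\<bar> \<le> \<bar>L\<bar> * \<bar>x - y\<bar>" if "t \<in> T" for t x y
    using assms(4)[OF that, of x y] by (meson abs_ge_self abs_ge_zero mult_right_mono order_trans)
  have sub: "{a..b} \<subseteq> T"
    and stT: "\<And>N n i. N \<ge> 1 \<Longrightarrow> n < N \<Longrightarrow> i \<in> {2,3,4} \<Longrightarrow> (a + real n * h N) + c i * h N \<in> T"
    using assms(2) unfolding contains_stage_times_def h_def by blast+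
  have ucont: "continuous_on {a..b} u"
    using assms(5) by (rule DERIV_continuous_on)
  have gcont: "continuous_on {a..b} (\<lambda>t. (t, u t))" by (intro continuous_intros ucont)
  have fucont: "continuous_on {a..b} (\<lambda>t. f t (u t))"
    using continuous_on_compose2[OF assms(3) gcont] sub by auto
  obtain M where M: "\<And>t. t \<in> {a..b} \<Longrightarrow> \<bar>u t\<bar> \<le> M" "\<And>t. t \<in> {a..b} \<Longrightarrow> \<bar>f t (u t)\<bar> \<le> M"
  proof -
    obtain M1 where "\<And>t. t \<in> {a..b} \<Longrightarrow> \<bar>u t\<bar> \<le> M1"
      using compact_imp_bounded[OF compact_continuous_image[OF ucont compact_Icc]]
      unfolding bounded_iff real_norm_def by blast
    moreover obtain M2 where "\<And>t. t \<in> {a..b} \<Longrightarrow> \<bar>f t (u t)\<bar> \<le> M2"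
      using compact_imp_bounded[OF compact_continuous_image[OF fucont compact_Icc]]
      unfolding bounded_iff real_norm_def by blast
    ultimately show ?thesis by (intro that[of "max M1 M2"]) (auto simp: le_max_iff_disj)
  qed
  obtain C where C: "\<And>N n i. N \<ge> 1 \<Longrightarrow> n < N \<Longrightarrow> i \<in> {2,3,4} \<Longrightarrow> \<bar>eps2 N n i\<bar> \<le> C"
    using assms(18) by blast
  obtain K where K: "0 \<le> K" and step:
    "\<And>f c e h t v w \<eta>.
      \<lbrakk>0 \<le> h; h \<le> \<eta>; \<eta> \<le> 1; \<bar>w\<bar> \<le> M; \<bar>f t w\<bar> \<le> M;
       \<And>x y. \<bar>f t x - f t y\<bar> \<le> \<bar>L\<bar> * \<bar>x - y\<bar>;
       \<And>i x y. i \<in> {2,3,4} \<Longrightarrow> \<bar>f (t + c i * h) x - f (t + c i * h) y\<bar> \<le> \<bar>L\<bar> * \<bar>x - y\<bar>;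
       \<And>i. i \<in> {2,3,4} \<Longrightarrow> \<bar>f (t + c i * h) w - f t w\<bar> \<le> \<eta>;
       \<And>i. i \<in> {2,3,4} \<Longrightarrow> \<bar>exp (- (e i * (c i * h)\<^sup>2)) - 1\<bar> \<le> \<eta>\<rbrakk>
      \<Longrightarrow> \<bar>rbf_rk4_step f A B c e h t v - (v + h * f t w)\<bar> \<le> h * (K * (\<bar>v - w\<bar> + \<eta>))"
    by (rule rbf_rk4_step_slope_error[OF abs_ge_zero[of L] assms(7), where M = M]) blast
  have small: "\<forall>\<^sub>F N in sequentially.
      \<bar>rbf_rk4 f A B c (eps2 N) (h N) a u0 N - u b\<bar> \<le> \<eta> * exp ((K + 1) * (b - a))"
    if \<eta>: "0 < \<eta>" "\<eta> \<le> 1" for \<eta>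
  proof -
    obtain d1 where d1: "0 < d1" "\<And>t h. a \<le> t \<Longrightarrow> t + h \<le> b \<Longrightarrow> 0 < h \<Longrightarrow> h < d1
        \<Longrightarrow> \<bar>u (t + h) - u t - h * f t (u t)\<bar> \<le> h * \<eta>"
      using euler_increment_error[OF assms(5) fucont \<eta>(1)] by blast
    have cpt: "compact ((\<lambda>t. (t, u t)) ` {a..b})" by (rule compact_continuous_image[OF gcont compact_Icc])
    have graph: "(\<lambda>t. (t, u t)) ` {a..b} \<subseteq> T \<times> UNIV" using sub by auto
    obtain d2 where d2: "0 < d2" "\<And>x y. x \<in> (\<lambda>t. (t, u t)) ` {a..b} \<Longrightarrow> y \<in> T \<times> UNIV
        \<Longrightarrow> dist y x < d2 \<Longrightarrow> dist (case y of (t, x) \<Rightarrow> f t x) (case x of (t, x) \<Rightarrow> f t x) < \<eta>"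
      by (rule continuous_on_uniform_at_compact[OF cpt graph assms(3) \<eta>(1)]) (rule that)
    have tim: "\<bar>f s (u t) - f t (u t)\<bar> \<le> \<eta>" if "t \<in> {a..b}" "s \<in> T" "\<bar>s - t\<bar> < d2" for s t
      using d2(2)[of "(t, u t)" "(s, u t)"] that by (auto simp: dist_Pair_Pair dist_real_def)
    have "\<forall>\<^sub>F N in sequentially. \<bar>c i * h N\<bar> < d2" for i
    proof -
      have "(\<lambda>N. \<bar>c i * h N\<bar>) \<longlonglongrightarrow> \<bar>c i * 0\<bar>" by (intro tendsto_intros h0)
      then show ?thesis using d2(1) by (intro order_tendstoD(2)) auto
    qed
    then have "\<forall>\<^sub>F N in sequentially. \<forall>i\<in>{2,3,4}. \<bar>c i * h N\<bar> < d2"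
      by (intro eventually_ball_finite) auto
    moreover have "\<forall>\<^sub>F N in sequentially. h N < min d1 \<eta>"
      using d1(1) \<eta>(1) by (intro order_tendstoD(2)[OF h0]) simp
    moreover have "\<forall>\<^sub>F N in sequentially. \<forall>n<N. \<forall>i\<in>{2,3,4}.
        \<bar>exp (- (eps2 N n i * (c i * h N)\<^sup>2)) - 1\<bar> \<le> \<eta>"
      by (rule damping_factor_near_one[OF C _ h0 \<eta>(1)]) auto
    moreover have "\<forall>\<^sub>F N in sequentially. N \<ge> (1::nat)" by (rule eventually_ge_at_top)
    ultimately show ?thesis
    proof eventually_elim
      case (elim N)
      define H where "H = h N"
      define t where "t = (\<lambda>n. a + real n * H)"
      define v where "v = rbf_rk4 f A B c (eps2 N) H a u0"
      \<comment> \<open>Adding \<open>\<eta>\<close> to the error absorbs the inhomogeneous term \<open>H * \<eta>\<close> of its recursion.\<close>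
      define x where "x = (\<lambda>n. \<bar>v n - u (t n)\<bar> + \<eta>)"
      have H: "0 < H" "real N * H = b - a"
        using elim(4) \<open>a < b\<close> by (auto simp: H_def h_def)
      have rec: "x (Suc n) \<le> (1 + H * (K + 1)) * x n" if n: "n < N" for n
      proof -
        have "real (Suc n) * H \<le> real N * H" using n H(1) by (intro mult_right_mono) auto
        then have tn: "a \<le> t n" "t n + H \<le> b" "t (Suc n) = t n + H"
          using H by (auto simp: t_def algebra_simps)
        have tT: "t n \<in> {a..b}" using tn H(1) by auto
        have sT: "t n + c i * H \<in> T" if "i \<in> {2,3,4}" for i
          using stT[OF elim(4) n that] by (simp add: t_def H_def)
        have "\<bar>rbf_rk4_step f A B c (eps2 N n) H (t n) (v n) - (v n + H * f (t n) (u (t n)))\<bar>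
            \<le> H * (K * (\<bar>v n - u (t n)\<bar> + \<eta>))"
        proof (rule step)
          show "\<bar>f (t n + c i * H) (u (t n)) - f (t n) (u (t n))\<bar> \<le> \<eta>" if "i \<in> {2,3,4}" for i
            using elim(1) that by (intro tim tT sT) (auto simp: H_def)
          show "\<bar>exp (- (eps2 N n i * (c i * H)\<^sup>2)) - 1\<bar> \<le> \<eta>" if "i \<in> {2,3,4}" for i
            using elim(3) n that by (auto simp: H_def)
          show "H \<le> \<eta>" using elim(2) by (simp add: H_def)
        qed (use H \<eta> M tT sub in \<open>auto intro!: lip sT\<close>)
        moreover have "v (Suc n) = rbf_rk4_step f A B c (eps2 N n) H (t n) (v n)"
          by (simp add: v_def t_def)
        moreover have "\<bar>u (t n + H) - u (t n) - H * f (t n) (u (t n))\<bar> \<le> H * \<eta>"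
          using elim(2) H tn by (intro d1(2)) (auto simp: H_def)
        ultimately have "\<bar>v (Suc n) - u (t (Suc n))\<bar>
            \<le> \<bar>v n - u (t n)\<bar> + H * (K * x n) + H * \<eta>"
          unfolding x_def tn(3) by linarith
        moreover have "H * \<eta> \<le> H * x n" using H(1) by (intro mult_left_mono) (auto simp: x_def)
        ultimately show ?thesis by (simp add: x_def algebra_simps)
      qed
      have x0: "x 0 = \<eta>" using assms(6) by (simp add: x_def v_def t_def)
      have "x N \<le> x 0 * exp (real N * (H * (K + 1)))"
        using rec by (rule linear_recursion_exp_bound) (use H K \<eta> x0 in auto)
      also have "real N * (H * (K + 1)) = (K + 1) * (b - a)"
        using H(2) by (metis mult.assoc mult.commute)
      finally show ?case
        using x0 H(2) \<eta>(1) by (simp add: x_def v_def t_def H_def)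
    qed
  qed
  have "(\<lambda>N. rbf_rk4 f A B c (eps2 N) (h N) a u0 N) \<longlonglongrightarrow> u b"
  proof (rule tendstoI)
    fix r :: real assume r: "0 < r"
    define R where "R = exp ((K + 1) * (b - a))"
    define \<eta> where "\<eta> = min 1 (r / (2 * R))"
    have R: "0 < R" by (simp add: R_def)
    have "\<eta> * R \<le> r / (2 * R) * R" using R by (intro mult_right_mono) (auto simp: \<eta>_def)
    also have "\<dots> < r" using r R by simp
    finally have less: "\<eta> * R < r" .
    have "0 < \<eta>" "\<eta> \<le> 1" using r R by (auto simp: \<eta>_def)
    from small[OF this]
    show "\<forall>\<^sub>F N in sequentially. dist (rbf_rk4 f A B c (eps2 N) (h N) a u0 N) (u b) < r"
      by eventually_elim (use less in \<open>auto simp: dist_real_def R_def\<close>)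
  qed
  then show ?thesis by (simp add: h_def)
qed

end
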